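(* Let $z \in (0,1)$ be irrational with continued fraction expansion $z = [a_0;a_1;a_2;\ldots]$ and convergents $r_n = p_n/q_n$. Furthermore let $N \in \mathbb{N}$ with $N \geq 2$ have (amended) Ostrowski representation $$N = \sum_{j=0}^m b_j q_j$$ with integer coefficients $b_0,b_1,\ldots,b_m$ satisfying $0 \leq b_j \leq a_{j+1}$ and minimal $m$ with $q_m + 1 \leq N < q_{m+1} + q_m$. If $z < \tfrac{1}{2}$, let $K_{2l-1} = \{ q_{2l-1} z \}$ and $K_{2l} = 1 - \{ q_{2l} z \}$ for $l \in \mathbb{N}_0$, and if $z > \tfrac{1}{2}$, let $K_{2l-1} = 1 - \{ q_{2l-1} z \}$ and $K_{2l} = \{ q_{2l} z \}$ for $l \in \mathbb{N}_0$. Then the finite sequence $(\{ n z \})_{n=1,\ldots,N-1}$ has at most three different lengths of gaps, namely \begin{align*} L_1 &= K_{m-1} - b_m K_m,\\ L_2 &= K_m,\\ L_3 &= L_1 + L_2. \end{align*} The numbers of gaps of lengths $L_1, L_2, L_3$ are, respectively, \begin{align*} N_1 &= N - b_m q_m - q_{m-1},\\ N_2 &= N - q_m,\\ N_3 &= q_m - (N - b_m q_m - q_{m-1}). \end{align*}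
   Context: For real $x$, $\{x\} = x - \lfloor x \rfloor$ denotes the fractional part, and $\mathbb{N}_0 = \{0,1,2,\ldots\}$. Every irrational $z$ has a unique infinite continued fraction expansion $z = a_0 + 1/(a_1 + 1/(a_2 + \cdots)) =: [a_0;a_1;a_2;\ldots]$ with integers $a_0 = \lfloor z \rfloor$ and $a_i \geq 1$ for $i \geq 1$. Its convergents $r_i = [a_0;a_1;\ldots;a_i] = p_i/q_i$ with $\gcd(p_i,q_i)=1$ are given by $p_{-2}=0$, $p_{-1}=1$, $p_i = a_i p_{i-1} + p_{i-2}$ and $q_{-2}=1$, $q_{-1}=0$, $q_i = a_i q_{i-1} + q_{i-2}$ for $i \geq 0$. The representation of $N$ used here is a slightly amended version of the Ostrowski representation: usually it is assumed that $0 \leq b_0 < a_1$ and that $b_{j-1} = 0$ if $b_j = a_{j+1}$, but not that $q_m + 1 \leq N < q_{m+1} + q_m$. Gaps: the points $\{nz\}$, $n=1,\ldots,N-1$, cut $[0,1)$ into $N$ subintervals; the gaps are these $N$ subintervals, counted with multiplicity. (Equivalently, they are the arcs between neighbouring points among the $N$ points $\{nz\}$, $n=0,1,\ldots,N-1$, on the circle $\mathbb{R}/\mathbb{Z}$.)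
   Formalization: For z < 1/2 the formulas for K of odd and even index are exchanged (as printed, N = 2 gives a gap of negative length); the representation must satisfy N_1 ≥ 0 (e.g. N = 2q_1 + 0·q_0 would give N_1 = -1), and one such representation is shown to exist for every N ≥ 2. *)

theory Defs
  imports Complex_Main
begin

(* cf_finite a n is the nested fraction [a 0; a 1; ...; a n]. *)
fun cf_finite :: "(nat \<Rightarrow> int) \<Rightarrow> nat \<Rightarrow> real" where
  "cf_finite a 0 = of_int (a 0)"
| "cf_finite a (Suc n) = of_int (a 0) + 1 / cf_finite (\<lambda>i. a (Suc i)) n"

definition cf_expansion :: "real \<Rightarrow> (nat \<Rightarrow> int) \<Rightarrow> bool" where
  "cf_expansion z a \<longleftrightarrow> a 0 = \<lfloor>z\<rfloor> \<and> (\<forall>i\<ge>1. a i \<ge> 1) \<and> cf_finite a \<longlonglongrightarrow> z"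

(* The index of p and q is an integer, so that the recursion can start at -2;
   below -2 the initial value is repeated, and no statement uses it there. *)
function cf_p :: "(nat \<Rightarrow> int) \<Rightarrow> int \<Rightarrow> int" where
  "cf_p a i = (if i \<le> - 2 then 0 else if i = - 1 then 1
               else a (nat i) * cf_p a (i - 1) + cf_p a (i - 2))"
  by pat_completeness auto
termination by (relation "measure (\<lambda>(a, i). nat (i + 2))") auto

function cf_q :: "(nat \<Rightarrow> int) \<Rightarrow> int \<Rightarrow> int" where
  "cf_q a i = (if i \<le> - 2 then 1 else if i = - 1 then 0
               else a (nat i) * cf_q a (i - 1) + cf_q a (i - 2))"
  by pat_completeness auto
termination by (relation "measure (\<lambda>(a, i). nat (i + 2))") auto

declare cf_p.simps [simp del] cf_q.simps [simp del]

lemma cf_p_init: "cf_p a (- 2) = 0" "cf_p a (- 1) = 1"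
  and cf_p_rec: "i \<ge> 0 \<Longrightarrow> cf_p a i = a (nat i) * cf_p a (i - 1) + cf_p a (i - 2)"
  by (subst cf_p.simps; simp)+

lemma cf_q_init: "cf_q a (- 2) = 1" "cf_q a (- 1) = 0"
  and cf_q_rec: "i \<ge> 0 \<Longrightarrow> cf_q a i = a (nat i) * cf_q a (i - 1) + cf_q a (i - 2)"
  by (subst cf_q.simps; simp)+

lemma cf_pq_shift:
  fixes a :: "nat \<Rightarrow> int"
  defines "s \<equiv> \<lambda>i. a (Suc i)"
  shows "cf_p a (int n) = a 0 * cf_p s (int n - 1) + cf_q s (int n - 1)
       \<and> cf_q a (int n) = cf_p s (int n - 1)"
proof (induction n rule: less_induct)
  case (less n)
  have p0: "cf_p a 0 = a 0" "cf_q a 0 = 1" for a :: "nat \<Rightarrow> int"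
    using cf_p_rec[of 0 a] cf_q_rec[of 0 a] by (simp_all add: cf_p_init cf_q_init)
  have p1: "cf_p a 1 = a 1 * a 0 + 1" "cf_q a 1 = a 1" for a :: "nat \<Rightarrow> int"
    using cf_p_rec[of 1 a] cf_q_rec[of 1 a] by (simp_all add: cf_p_init cf_q_init p0)
  consider "n = 0" | "n = 1" | k where "n = Suc (Suc k)"
    by (metis One_nat_def not0_implies_Suc)
  then show ?case
  proof cases
    case 1
    then show ?thesis by (simp add: p0 cf_p_init cf_q_init)
  next
    case 2
    then show ?thesis by (simp add: p0 p1 s_def algebra_simps)
  next
    case (3 k)
    have i1: "int n - 1 = int (Suc k)" and i2: "int n - 2 = int k" using 3 by auto
    have ih1: "cf_p a (int n - 1) = a 0 * cf_p s (int k) + cf_q s (int k)"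
        "cf_q a (int n - 1) = cf_p s (int k)"
      using less.IH[of "Suc k"] 3 i1 by auto
    have ih2: "cf_p a (int n - 2) = a 0 * cf_p s (int k - 1) + cf_q s (int k - 1)"
        "cf_q a (int n - 2) = cf_p s (int k - 1)"
      using less.IH[of k] 3 i2 by auto
    have sn: "s (Suc k) = a n" by (simp add: s_def 3)
    have "nat (1 + int k) = Suc k" by simp
    then have rs: "cf_p s (int n - 1) = a n * cf_p s (int k) + cf_p s (int k - 1)"
        "cf_q s (int n - 1) = a n * cf_q s (int k) + cf_q s (int k - 1)"
      unfolding i1 using cf_p_rec[of "int (Suc k)" s] cf_q_rec[of "int (Suc k)" s]
      by (simp_all add: sn)
    show ?thesis
      unfolding rs using cf_p_rec[of "int n" a] cf_q_rec[of "int n" a]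
      by (simp add: ih1 ih2 algebra_simps)
  qed
qed

lemma cf_p_pos:
  assumes "\<And>i. a i \<ge> 1"
  shows "cf_p a (int n) \<ge> 1"
proof (induction n rule: less_induct)
  case (less n)
  consider "n = 0" | "n = 1" | k where "n = Suc (Suc k)"
    by (metis One_nat_def not0_implies_Suc)
  then show ?case
  proof cases
    case 1
    then show ?thesis using cf_p_rec[of 0 a] assms[of 0] by (simp add: cf_p_init)
  next
    case 2
    then show ?thesis
      using cf_p_rec[of 1 a] cf_p_rec[of 0 a] mult_mono[of 1 "a 1" 1 "a 0"] assms[of 0] assms[of 1]
      by (simp add: cf_p_init)
  next
    case (3 k)
    have "cf_p a (int (Suc k)) \<ge> 1" "cf_p a (int k) \<ge> 1"
      using less.IH[of "Suc k"] less.IH[of k] 3 by auto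
    moreover have "int n - 1 = int (Suc k)" "int n - 2 = int k" using 3 by auto
    then have "cf_p a (int n) = a n * cf_p a (int (Suc k)) + cf_p a (int k)"
      using cf_p_rec[of "int n" a] by (metis nat_int of_nat_0_le_iff)
    moreover have "1 \<le> a n * cf_p a (int (Suc k))"
      using mult_mono[of 1 "a n" 1 "cf_p a (int (Suc k))"] calculation(1) assms[of n] by linarith
    ultimately show ?thesis by linarith
  qed
qed

lemma cf_finite_eq_convergent:
  assumes "\<And>i. i \<ge> 1 \<Longrightarrow> a i \<ge> 1"
  shows "cf_finite a n = of_int (cf_p a (int n)) / of_int (cf_q a (int n))"
  using assms
proof (induction n arbitrary: a)
  case 0
  then show ?case using cf_p_rec[of 0 a] cf_q_rec[of 0 a] by (simp add: cf_p_init cf_q_init)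
next
  case (Suc n)
  let ?s = "\<lambda>i. a (Suc i)"
  have s: "?s i \<ge> 1" for i using Suc.prems[of "Suc i"] by simp
  have pos: "cf_p ?s (int n) \<ge> 1" by (rule cf_p_pos) (rule s)
  have ih: "cf_finite ?s n = of_int (cf_p ?s (int n)) / of_int (cf_q ?s (int n))"
    by (rule Suc.IH) (rule s)
  have "cf_p a (int (Suc n)) = a 0 * cf_p ?s (int n) + cf_q ?s (int n)"
    and "cf_q a (int (Suc n)) = cf_p ?s (int n)"
    using cf_pq_shift[of a "Suc n"] by auto
  then show ?case using pos ih by (simp add: field_simps)
qed

(* The digits are not unique: the usual Ostrowski conditions (b 0 < a 1, and b (j - 1) = 0
   whenever b j = a (j + 1)) are not imposed. *)
definition amended_ostrowski :: "(nat \<Rightarrow> int) \<Rightarrow> nat \<Rightarrow> nat \<Rightarrow> (nat \<Rightarrow> int) \<Rightarrow> bool" where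
  "amended_ostrowski a N m b \<longleftrightarrow>
     (let in_range = (\<lambda>k::nat. cf_q a (int k) + 1 \<le> int N \<and>
                               int N < cf_q a (int k + 1) + cf_q a (int k))
      in int N = (\<Sum>j=0..m. b j * cf_q a (int j)) \<and>
         (\<forall>j\<le>m. 0 \<le> b j \<and> b j \<le> a (j + 1)) \<and>
         in_range m \<and> (\<forall>k<m. \<not> in_range k))"

(* For i >= -1 and irrational z with 0 < z < 1 this is the distance from q i * z to the
   integer p i, because even convergents lie below z and odd ones above it; in particular
   K (-1) = 1 - frac 0 = 1. This holds on both sides of z = 1/2; exchanging the two
   formulas for z < 1/2 would give K 0 = 1 - z and K (-1) = 0, which is not that distance. *)
definition cf_K :: "real \<Rightarrow> (nat \<Rightarrow> int) \<Rightarrow> int \<Rightarrow> real" where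
  "cf_K z a i = (if even i then frac (of_int (cf_q a i) * z) else 1 - frac (of_int (cf_q a i) * z))"

(* The lengths, from left to right, of the N intervals into which [0,1) is cut by the
   fractional parts of n * z for n = 1..N-1; repeated points give gaps of length 0. *)
definition gap_lengths :: "real \<Rightarrow> nat \<Rightarrow> real list" where
  "gap_lengths z N =
     (let cuts = 0 # sort (map (\<lambda>n. frac (real n * z)) [1..<N]) @ [1]
      in map2 (\<lambda>x y. y - x) cuts (tl cuts))"

end

theory Submission
  imports Defs "HOL-Library.Multiset"
begin

text \<open>
  Place the points \<open>n z\<close>, \<open>n < N\<close>, on the circle of length 1. Write \<open>m\<close> for the top index,
  \<open>q = q\<^sub>m\<close>, \<open>c = b\<^sub>m\<close> and \<open>Q = c q\<^sub>m + q\<^sub>m\<^sub>-\<^sub>1\<close>. The steps \<open>q\<close> and \<open>Q\<close>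
  are close returns from opposite sides: adding one of them to \<open>n\<close> moves the point forwards by a
  small amount, subtracting the other does so too, and the two amounts are \<open>K\<^sub>m\<close> and
  \<open>K\<^sub>m\<^sub>-\<^sub>1 - c K\<^sub>m\<close>. By the bounds on the digits, the choice of \<open>m\<close> and
  the nonnegativity of \<open>N\<^sub>1\<close>, the number \<open>N\<close> lies between \<open>max q Q\<close> and \<open>q + Q\<close>. Hence every
  \<open>n < N\<close> admits one of the two moves, or else both together, without leaving \<open>{0..<N}\<close>. So the
  gap to the right of the point \<open>n\<close> is at most the length of that move.

  Counting how often each move is used
  turns the total length of all moves into the determinant of two neighbouring (intermediate)
  convergents, which is 1, the total length of all gaps. Hence every inequality between a gap and
  its move is an equality, and the gap lengths and their multiplicities are those of the moves
  (\<open>mset_gap_lengths_if_tiling\<close>, \<open>mset_gap_lengths_three\<close>).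

  Two things remain. The quantities \<open>K\<^sub>i\<close> have to be identified with the distances
  \<open>\<bar>q\<^sub>i z - p\<^sub>i\<bar>\<close>, which rests on the convergents lying alternately below and above \<open>z\<close>
  (\<open>cf_K_eq_cf_dist\<close>). And digits have to be shown to exist and to keep \<open>N\<close> below
  \<open>q + Q\<close> (\<open>amended_ostrowski_exists\<close>, \<open>digit_sum_less\<close>).
\<close>

section \<open>Gaps that are squeezed by a tiling of the circle\<close>

lemma list_eq_of_le_and_sum_eq:
  fixes xs ys :: "real list"
  assumes "length xs = length ys" and "\<And>i. i < length xs \<Longrightarrow> xs ! i \<le> ys ! i"
    and "sum_list xs = sum_list ys"
  shows "xs = ys"
proof (rule nth_equalityI)
  fix i assume i: "i < length xs"
  have "(\<Sum>i<length xs. ys ! i - xs ! i) = 0"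
    using assms(1,3) by (simp add: sum_subtractf sum_list_sum_nth atLeast0LessThan)
  then have "ys ! i - xs ! i = 0"
    using assms(2) i by (subst (asm) sum_nonneg_eq_0_iff) auto
  then show "xs ! i = ys ! i" by simp
qed (rule assms(1))

lemma sort_map_eq_map_sort_key:
  fixes f :: "'a::linorder \<Rightarrow> 'b::linorder"
  shows "sort (map f xs) = map f (sort_key f xs)"
  by (rule properties_for_sort) auto

text \<open>
  Moving from the point \<open>n\<close> forwards by \<open>d n\<close> ends, up to full turns, at another point, so the gap
  after \<open>n\<close> is at most \<open>d n\<close>. Both the gaps and the moves add up to 1, which leaves no room for
  strict inequality.
\<close>
lemma mset_gap_lengths_if_tiling:
  fixes z :: real and d :: "nat \<Rightarrow> real"
  assumes N: "N \<ge> 1"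
    and step: "\<And>n. n < N \<Longrightarrow> \<exists>k<N. \<exists>j::int. frac (real n * z) + d n = frac (real k * z) + of_int j"
    and pos: "\<And>n. n < N \<Longrightarrow> d n > 0"
    and total: "(\<Sum>n<N. d n) = 1"
  shows "mset (gap_lengths z N) = image_mset d (mset [0..<N])"
proof -
  define x where "x = (\<lambda>n. frac (real n * z))"
  \<comment> \<open>\<open>ns\<close> lists the indices in the order of their points, so \<open>d\<close> can be compared with the gaps
      position by position.\<close>
  define ns where "ns = sort_key x [0..<N]"
  define cuts where "cuts = map x ns @ [1]"
  have len: "length ns = N" by (simp add: ns_def)
  have set_ns: "set ns = {..<N}" by (auto simp: ns_def)
  have msns: "mset ns = mset [0..<N]" by (simp add: ns_def)
  have "[0..<N] = 0 # [1..<N]" using N by (simp add: upt_conv_Cons)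
  then have "sort (map x [0..<N]) = 0 # sort (map x [1..<N])"
    by (intro properties_for_sort) (auto simp: x_def)
  then have cuts: "0 # sort (map (\<lambda>n. frac (real n * z)) [1..<N]) @ [1] = cuts"
    unfolding cuts_def ns_def x_def by (simp flip: sort_map_eq_map_sort_key)
  have x01: "0 \<le> x n" "x n < 1" for n by (auto simp: x_def frac_lt_1)
  have cuts0: "cuts ! 0 = 0"
    unfolding cuts[symmetric] by simp
  have sorted: "sorted cuts"
    unfolding cuts_def using x01 by (auto simp: sorted_append ns_def less_imp_le)
  define g where "g = (\<lambda>i. cuts ! Suc i - cuts ! i)"
  have gaps: "gap_lengths z N = map g [0..<N]"
    unfolding gap_lengths_def Let_def cuts
    by (rule nth_equalityI) (auto simp: cuts_def len g_def nth_tl)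
  have le: "g i \<le> d (ns ! i)" if i: "i < N" for i
  proof -
    define n where "n = ns ! i"
    have n: "n < N" using i set_ns len nth_mem n_def by fastforce
    have ci: "cuts ! i = x n" using i len by (simp add: cuts_def n_def nth_append)
    obtain k j where k: "k < N" and j: "x n + d n = x k + of_int j"
      using step[OF n] by (auto simp: x_def)
    \<comment> \<open>A move that passes the end of the interval covers the rest of it; otherwise it ends at a later
        point, which is at least as far as the next cut.\<close>
    have "cuts ! Suc i \<le> x n + d n"
    proof (cases "j \<ge> 1")
      case True
      then have "x n + d n \<ge> 1" using j x01(1)[of k] by linarith
      moreover have "cuts ! Suc i \<le> cuts ! N"
        using sorted i len by (intro sorted_nth_mono) (auto simp: cuts_def)
      moreover have "cuts ! N = 1" by (simp add: cuts_def nth_append len)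
      ultimately show ?thesis by simp
    next
      case False
      then have "x k \<ge> x n + d n" using j by linarith
      then have gt: "x k > x n" using pos[OF n] by linarith
      from k set_ns obtain l where l: "l < N" "ns ! l = k"
        by (metis in_set_conv_nth len lessThan_iff)
      have cl: "cuts ! l = x k" using l len by (simp add: cuts_def nth_append)
      have "\<not> l \<le> i"
        using sorted_nth_mono[OF sorted, of l i] i len gt cl ci by (auto simp: cuts_def)
      then have "cuts ! Suc i \<le> x k"
        using sorted_nth_mono[OF sorted, of "Suc i" l] l len cl by (auto simp: cuts_def)
      moreover have "j = 0" using False gt j x01[of k] x01[of n] pos[OF n] by linarith
      ultimately show ?thesis using j by simp
    qed
    then show ?thesis using ci by (simp add: g_def n_def)
  qed
  have "sum_list (map g [0..<N]) = cuts ! N - cuts ! 0"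
    unfolding g_def using sum_lessThan_telescope[of "\<lambda>i. cuts ! i" N]
    by (simp add: sum_list_sum_nth atLeast0LessThan)
  also have "\<dots> = sum_list (map d [0..<N])"
    using total cuts0 by (simp add: cuts_def nth_append len sum_list_sum_nth atLeast0LessThan)
  also have "\<dots> = sum_mset (image_mset d (mset ns))"
    unfolding msns by (metis mset_map sum_mset_sum_list)
  also have "\<dots> = sum_list (map d ns)"
    by (metis mset_map sum_mset_sum_list)
  finally have "map g [0..<N] = map d ns"
    by (intro list_eq_of_le_and_sum_eq) (auto simp: le len)
  then show ?thesis unfolding gaps by (simp add: msns)
qed

text \<open>
  The three gap theorem for an arbitrary pair of steps \<open>u\<close> and \<open>v\<close>, where \<open>u\<close> moves forwards by
  \<open>A\<close> and \<open>v\<close> backwards by \<open>B\<close>. The index \<open>n\<close> goes to \<open>n + u\<close> or to \<open>n - v\<close>, whichever lies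
  in \<open>{0..<N}\<close>; the bound \<open>N \<le> u + v\<close> excludes that both do, and when neither does,
  \<open>n + u - v\<close> lies there. These moves have total length \<open>v A + u B = u t - v s\<close>.
\<close>
lemma mset_gap_lengths_three:
  fixes z A B :: real and u v N :: nat and s t :: int
  assumes N: "N \<ge> 1" "u \<le> N" "v \<le> N" "N \<le> u + v"
    and A: "A = real u * z - of_int s" "A > 0"
    and B: "B = of_int t - real v * z" "B > 0"
    and det: "int u * t - int v * s = 1"
  shows "mset (gap_lengths z N) =
    replicate_mset (N - u) A + replicate_mset (N - v) B + replicate_mset (u + v - N) (A + B)"
proof -
  define d where "d = (\<lambda>n. if n < N - u then A else if v \<le> n then B else A + B)"
  have split: "[0..<N] = [0..<N - u] @ [N - u..<v] @ [v..<N]"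
  proof -
    have "[N - u..<N] = [N - u..<v] @ [v..<N]"
      using upt_add_eq_append[of "N - u" v "N - v"] N by simp
    then show ?thesis using upt_add_eq_append[of 0 "N - u" u] N by simp
  qed
  have "map d [0..<N - u] = replicate (N - u) A"
    "map d [N - u..<v] = replicate (u + v - N) (A + B)"
    "map d [v..<N] = replicate (N - v) B"
    using N by (auto simp: d_def map_replicate_const[symmetric] intro!: nth_equalityI)
  then have d_list: "map d [0..<N] =
      replicate (N - u) A @ replicate (u + v - N) (A + B) @ replicate (N - v) B"
    unfolding split by simp
  have "(\<Sum>n<N. d n) = sum_list (map d [0..<N])"
    by (simp add: sum_list_sum_nth atLeast0LessThan)
  also have "\<dots> = real v * A + real u * B"
    unfolding d_list using N by (simp add: sum_list_replicate of_nat_diff algebra_simps)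
  also have "\<dots> = of_int (int u * t - int v * s)"
    by (simp add: A B algebra_simps)
  finally have total: "(\<Sum>n<N. d n) = 1" unfolding det by simp
  have "mset (gap_lengths z N) = image_mset d (mset [0..<N])"
  proof (rule mset_gap_lengths_if_tiling)
    fix n assume n: "n < N"
    show "d n > 0" using A B by (auto simp: d_def)
    have neighbour: "\<exists>k<N. \<exists>j::int. frac (real n * z) + d n = frac (real k * z) + of_int j"
      if "k < N" "d n = (real k - real n) * z + of_int l" for k l
      using that by (intro exI[of _ k] conjI exI[of _ "\<lfloor>real k * z\<rfloor> - \<lfloor>real n * z\<rfloor> + l"])
        (auto simp: frac_def algebra_simps)
    consider "n < N - u" | "n \<ge> N - u" "v \<le> n" | "n \<ge> N - u" "n < v" by linarith
    then show "\<exists>k<N. \<exists>j::int. frac (real n * z) + d n = frac (real k * z) + of_int j"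
    proof cases
      case 1
      then show ?thesis by (intro neighbour[of "n + u" "- s"]) (auto simp: d_def A)
    next
      case 2
      then show ?thesis using n N
        by (intro neighbour[of "n - v" t]) (auto simp: d_def B of_nat_diff algebra_simps)
    next
      case 3
      then show ?thesis using n N
        by (intro neighbour[of "n + u - v" "t - s"]) (auto simp: d_def A B of_nat_diff algebra_simps)
    qed
  qed (use N total in auto)
  also have "\<dots> = mset (map d [0..<N])" by simp
  finally show ?thesis unfolding d_list by (simp add: ac_simps)
qed

section \<open>Convergents\<close>

lemma cf_q_step: "cf_q a (int k + 1) = a (Suc k) * cf_q a (int k) + cf_q a (int k - 1)"
  using cf_q_rec[of "int k + 1" a] by (simp add: nat_add_distrib)

lemma cf_p_step: "cf_p a (int k + 1) = a (Suc k) * cf_p a (int k) + cf_p a (int k - 1)"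
  using cf_p_rec[of "int k + 1" a] by (simp add: nat_add_distrib)

lemma cf_pq_zero: "cf_p a 0 = a 0" "cf_q a 0 = 1"
  using cf_p_rec[of 0 a] cf_q_rec[of 0 a] by (simp_all add: cf_p_init cf_q_init)

lemma cf_determinant:
  "cf_q a (int k) * cf_p a (int k - 1) - cf_p a (int k) * cf_q a (int k - 1) = (- 1) ^ k"
proof (induction k)
  case 0
  show ?case by (simp add: cf_pq_zero cf_p_init cf_q_init)
next
  case (Suc k)
  then show ?case
    using cf_p_step[of a k] cf_q_step[of a k] by (simp add: algebra_simps)
qed

lemma cf_q_pos:
  assumes "\<And>i. i \<ge> 1 \<Longrightarrow> a i \<ge> 1"
  shows "cf_q a (int k) \<ge> 1"
proof (cases k)
  case (Suc l)
  then show ?thesis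
    using cf_pq_shift[of a k] cf_p_pos[of "\<lambda>i. a (Suc i)" l] assms by simp
qed (simp add: cf_pq_zero)

lemma cf_q_nonneg:
  assumes "\<And>i. i \<ge> 1 \<Longrightarrow> a i \<ge> 1"
  shows "cf_q a (int k - 1) \<ge> 0"
proof (cases k)
  case (Suc l)
  then show ?thesis using cf_q_pos[of a l] assms by simp
qed (simp add: cf_q_init)

lemma cf_q_mono:
  assumes a: "\<And>i. i \<ge> 1 \<Longrightarrow> a i \<ge> 1"
  shows "cf_q a (int k - 1) \<le> cf_q a (int k)"
proof (cases k)
  case (Suc l)
  have "cf_q a (int l) \<le> a (Suc l) * cf_q a (int l)"
    using a[of "Suc l"] cf_q_pos[of a l] a by (simp add: mult_le_cancel_right1)
  then show ?thesis
    using Suc cf_q_step[of a l] cf_q_nonneg[of a l] a by (simp add: add.commute)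
qed (simp add: cf_q_init cf_pq_zero)

lemma cf_q_sum_unbounded:
  assumes a: "\<And>i. i \<ge> 1 \<Longrightarrow> a i \<ge> 1"
  shows "int k < cf_q a (int k + 1) + cf_q a (int k)"
proof (induction k)
  case 0
  show ?case using cf_q_pos[of a 1] a by (simp add: cf_pq_zero)
next
  case (Suc k)
  have "cf_q a (int (Suc k)) \<ge> 1" "cf_q a (int k) \<ge> 1" "a (Suc (Suc k)) \<ge> 1"
    using a by (auto intro: cf_q_pos simp del: of_nat_Suc)
  moreover from this have "1 * cf_q a (int (Suc k)) \<le> a (Suc (Suc k)) * cf_q a (int (Suc k))"
    by (intro mult_right_mono) auto
  moreover have "cf_q a (int (Suc k) + 1) =
      a (Suc (Suc k)) * cf_q a (int (Suc k)) + cf_q a (int k)"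
    using cf_q_step[of a "Suc k"] by simp
  moreover have "int k < cf_q a (int (Suc k)) + cf_q a (int k)"
    using Suc.IH by (simp add: add.commute)
  ultimately show ?case by linarith
qed

text \<open>
  The distance \<open>\<bar>q\<^sub>i z - p\<^sub>i\<bar>\<close>, with the sign \<open>(- 1)\<^sup>i\<close> in place of the absolute value, so that it
  satisfies a linear recurrence. The argument is \<open>k = i + 1\<close>, which makes the sequence start at
  \<open>i = - 1\<close> with the value 1 and allows induction on a natural number.
\<close>
definition cf_dist :: "real \<Rightarrow> (nat \<Rightarrow> int) \<Rightarrow> nat \<Rightarrow> real" where
  "cf_dist z a k =
     (- 1) ^ (k + 1) * (of_int (cf_q a (int k - 1)) * z - of_int (cf_p a (int k - 1)))"

lemma cf_dist_step:
  "cf_dist z a (Suc (Suc k)) = cf_dist z a k - of_int (a (Suc k)) * cf_dist z a (Suc k)"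
  using cf_p_step[of a k] cf_q_step[of a k] by (simp add: cf_dist_def algebra_simps)

text \<open>
  The difference is \<open>(- 1)\<^sup>k a\<^sub>k\<^sub>+\<^sub>2 / (q\<^sub>k q\<^sub>k\<^sub>+\<^sub>2)\<close>: even convergents increase and odd
  ones decrease.
\<close>
lemma cf_finite_two_step:
  assumes a: "\<And>i. i \<ge> 1 \<Longrightarrow> a i \<ge> 1"
  shows "(- 1) ^ k * (cf_finite a (Suc (Suc k)) - cf_finite a k) \<ge> 0"
proof -
  have q: "cf_q a (int k) > 0" "cf_q a (int k + 2) > 0"
    using cf_q_pos[of a k] cf_q_pos[of a "k + 2"] a by (force simp: add.commute)+
  have "cf_p a (int k + 2) * cf_q a (int k) - cf_p a (int k) * cf_q a (int k + 2) =
      a (Suc (Suc k)) * (- 1) ^ k"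
  proof -
    let ?c = "a (Suc (Suc k))"
    have "cf_p a (int k + 2) = ?c * cf_p a (int k + 1) + cf_p a (int k)"
      "cf_q a (int k + 2) = ?c * cf_q a (int k + 1) + cf_q a (int k)"
      using cf_p_step[of a "Suc k"] cf_q_step[of a "Suc k"] by (simp_all add: add.commute)
    then have "cf_p a (int k + 2) * cf_q a (int k) - cf_p a (int k) * cf_q a (int k + 2) =
        - ?c * (cf_q a (int k + 1) * cf_p a (int k) - cf_p a (int k + 1) * cf_q a (int k))"
      by (simp add: algebra_simps)
    also have "cf_q a (int k + 1) * cf_p a (int k) - cf_p a (int k + 1) * cf_q a (int k) =
        (- 1) ^ Suc k"
      using cf_determinant[of a "Suc k"] by (simp add: add.commute)
    finally show ?thesis by simp
  qed
  then have "of_int (cf_p a (int k + 2)) * of_int (cf_q a (int k)) -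
      of_int (cf_p a (int k)) * of_int (cf_q a (int k + 2)) =
      real_of_int (a (Suc (Suc k))) * (- 1) ^ k"
    by (metis (mono_tags) of_int_diff of_int_minus of_int_mult of_int_power of_int_1)
  then have "cf_finite a (Suc (Suc k)) - cf_finite a k = of_int (a (Suc (Suc k))) * (- 1) ^ k /
      (of_int (cf_q a (int k + 2)) * of_int (cf_q a (int k)))"
    using q cf_finite_eq_convergent[of a k] cf_finite_eq_convergent[of a "k + 2"] a
    by (simp add: add.commute diff_frac_eq)
  then have "(- 1) ^ k * (cf_finite a (Suc (Suc k)) - cf_finite a k) = of_int (a (Suc (Suc k))) /
      (of_int (cf_q a (int k + 2)) * of_int (cf_q a (int k)))"
    by (simp flip: power_add mult_2)
  then show ?thesis using q a[of "Suc (Suc k)"] by simp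
qed

text \<open>
  The convergents whose index has the parity of \<open>k\<close> tend to \<open>z\<close> monotonically, so each of them
  stays on one side of the limit.
\<close>
lemma convergents_alternate:
  assumes a: "cf_expansion z a"
  shows "(- 1) ^ k * (z - cf_finite a k) \<ge> 0"
proof -
  have pos: "a i \<ge> 1" if "i \<ge> 1" for i using a that by (auto simp: cf_expansion_def)
  define r where "r = (\<lambda>j. (- 1) ^ k * cf_finite a (2 * j + k))"
  have "incseq r"
  proof (rule incseq_SucI)
    fix j
    show "r j \<le> r (Suc j)"
      using cf_finite_two_step[of a "2 * j + k"] pos by (simp add: r_def algebra_simps power_add)
  qed
  moreover have "r \<longlonglongrightarrow> (- 1) ^ k * z"
  proof -
    have "strict_mono (\<lambda>j::nat. 2 * j + k)" by (simp add: strict_mono_def)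
    from LIMSEQ_subseq_LIMSEQ[OF _ this, of "cf_finite a" z] a
    show ?thesis unfolding r_def by (intro tendsto_mult) (auto simp: cf_expansion_def o_def)
  qed
  ultimately have "r 0 \<le> (- 1) ^ k * z" by (rule incseq_le)
  then show ?thesis by (simp add: r_def algebra_simps)
qed

lemma irrational_linear:
  assumes "z \<notin> \<rat>" "of_int x * z = of_int y"
  shows "x = 0"
proof (rule ccontr)
  assume "x \<noteq> 0"
  then have "z = of_int y / of_int x" using assms by (simp add: field_simps)
  then show False using assms(1) by auto
qed

lemma cf_dist_pos:
  assumes z: "z \<notin> \<rat>" and a: "cf_expansion z a"
  shows "cf_dist z a k > 0"
proof (cases k)
  case 0
  then show ?thesis by (simp add: cf_dist_def cf_p_init cf_q_init)
next
  case (Suc l)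
  have pos: "a i \<ge> 1" if "i \<ge> 1" for i using a that by (auto simp: cf_expansion_def)
  then have q: "cf_q a (int l) \<ge> 1" by (rule cf_q_pos)
  have "cf_dist z a k = of_int (cf_q a (int l)) * ((- 1) ^ l * (z - cf_finite a l))"
    using q pos by (simp add: Suc cf_dist_def cf_finite_eq_convergent algebra_simps)
  moreover have "\<dots> \<ge> 0" using q convergents_alternate[OF a, of l] by simp
  moreover have "cf_dist z a k \<noteq> 0"
    using irrational_linear[OF z, of "cf_q a (int l)" "cf_p a (int l)"] q
    by (auto simp: Suc cf_dist_def)
  ultimately show ?thesis by linarith
qed

lemma cf_dist_less_1:
  assumes z: "z \<notin> \<rat>" "0 < z" "z < 1" and a: "cf_expansion z a"
  shows "cf_dist z a (Suc k) < 1"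
proof -
  have decr: "cf_dist z a (Suc (Suc k)) < cf_dist z a k" for k
  proof -
    have "a (Suc k) \<ge> 1" using a by (simp add: cf_expansion_def)
    then show ?thesis using cf_dist_pos[OF z(1) a, of "Suc k"]
      by (simp add: cf_dist_step)
  qed
  have 0: "cf_dist z a 0 = 1" by (simp add: cf_dist_def cf_p_init cf_q_init)
  have "a 0 = 0" using a z by (simp add: cf_expansion_def floor_eq_iff)
  then have 1: "cf_dist z a 1 < 1" using z by (simp add: cf_dist_def cf_pq_zero)
  show ?thesis
  proof (induction k rule: induct_nat_012)
    case 1
    then show ?case using decr[of 0] 0 by simp
  next
    case (ge2 k)
    then show ?case using decr[of "Suc k"] by simp
  qed (use 1 in simp)
qed

text \<open>
  The distances lie strictly between 0 and 1 from \<open>i = 0\<close> on, hence \<open>p\<^sub>i\<close> (for even \<open>i\<close>) or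
  \<open>p\<^sub>i - 1\<close> (for odd \<open>i\<close>) is the integer part of \<open>q\<^sub>i z\<close>. At \<open>i = - 1\<close> the distance is exactly 1,
  which the odd case tolerates because there the fractional part is 0.
\<close>
lemma cf_K_eq_cf_dist:
  assumes z: "z \<notin> \<rat>" "0 < z" "z < 1" and a: "cf_expansion z a"
  shows "cf_K z a (int k - 1) = cf_dist z a k"
proof (cases "even k")
  case True
  let ?x = "of_int (cf_q a (int k - 1)) * z"
  have D: "cf_dist z a k = of_int (cf_p a (int k - 1)) - ?x" using True by (simp add: cf_dist_def)
  have "cf_dist z a k \<le> 1"
    using cf_dist_less_1[OF z a] by (cases k) (auto simp: cf_dist_def cf_p_init cf_q_init less_imp_le)
  then have "\<lfloor>?x\<rfloor> = cf_p a (int k - 1) - 1"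
    using D cf_dist_pos[OF z(1) a, of k] by (simp add: floor_eq_iff)
  then show ?thesis using True D by (simp add: cf_K_def frac_def)
next
  case False
  let ?x = "of_int (cf_q a (int k - 1)) * z"
  have D: "cf_dist z a k = ?x - of_int (cf_p a (int k - 1))" using False by (simp add: cf_dist_def)
  obtain l where "k = Suc l" using False by (cases k) auto
  then have "\<lfloor>?x\<rfloor> = cf_p a (int k - 1)"
    using D cf_dist_pos[OF z(1) a, of k] cf_dist_less_1[OF z a, of l] by (simp add: floor_eq_iff)
  then show ?thesis using False D by (simp add: cf_K_def frac_def)
qed

section \<open>Ostrowski digits\<close>

text \<open>
  With all digits maximal the sum telescopes, as \<open>a\<^sub>j\<^sub>+\<^sub>1 q\<^sub>j = q\<^sub>j\<^sub>+\<^sub>1 - q\<^sub>j\<^sub>-\<^sub>1\<close>.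
\<close>
lemma digit_sum_less:
  assumes a: "\<And>i. i \<ge> 1 \<Longrightarrow> a i \<ge> 1" and b: "\<And>j. j < m \<Longrightarrow> b j \<le> a (j + 1)"
  shows "(\<Sum>j<m. b j * cf_q a (int j)) < cf_q a (int m) + cf_q a (int m - 1)"
  using b
proof (induction m)
  case 0
  show ?case by (simp add: cf_pq_zero cf_q_init)
next
  case (Suc m)
  have "b m * cf_q a (int m) \<le> a (Suc m) * cf_q a (int m)"
    using Suc.prems[of m] cf_q_pos[of a m] a by (intro mult_right_mono) auto
  then show ?case using Suc cf_q_step[of a m] by (simp add: add.commute)
qed

text \<open>
  The bound of \<open>digit_sum_less\<close> is sharp. Taking the largest admissible top digit leaves a
  remainder that obeys the same bound one level lower: either the digit is the full quotient and the
  remainder is below \<open>q\<^sub>m\<close>, or it is \<open>a\<^sub>m\<^sub>+\<^sub>1\<close> and the recurrence for \<open>q\<close> gives the bound.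
\<close>
lemma greedy_digits_exist:
  assumes a: "\<And>i. i \<ge> 1 \<Longrightarrow> a i \<ge> 1"
    and R: "0 \<le> R" "R < cf_q a (int m) + cf_q a (int m - 1)"
  shows "\<exists>b. R = (\<Sum>j<m. b j * cf_q a (int j)) \<and> (\<forall>j<m. 0 \<le> b j \<and> b j \<le> a (j + 1))"
  using R
proof (induction m arbitrary: R)
  case 0
  then show ?case by (simp add: cf_pq_zero cf_q_init)
next
  case (Suc m)
  have q: "cf_q a (int m) \<ge> 1" "cf_q a (int m - 1) \<ge> 0"
    using cf_q_pos[of a m] cf_q_nonneg[of a m] a by auto
  define c where "c = min (a (Suc m)) (R div cf_q a (int m))"
  have c: "0 \<le> c" "c \<le> a (Suc m)"
    using a[of "Suc m"] Suc.prems q by (auto simp: c_def pos_imp_zdiv_nonneg_iff)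
  have mod: "R = (R div cf_q a (int m)) * cf_q a (int m) + R mod cf_q a (int m)"
    by (rule div_mult_mod_eq[symmetric])
  have mod_bounds: "0 \<le> R mod cf_q a (int m)" "R mod cf_q a (int m) < cf_q a (int m)"
    using q by auto
  have "c * cf_q a (int m) \<le> (R div cf_q a (int m)) * cf_q a (int m)"
    using q by (intro mult_right_mono) (auto simp: c_def)
  then have "0 \<le> R - c * cf_q a (int m)" using mod mod_bounds by linarith
  moreover have "R - c * cf_q a (int m) < cf_q a (int m) + cf_q a (int m - 1)"
  proof (cases "R div cf_q a (int m) \<le> a (Suc m)")
    case True
    then have "c * cf_q a (int m) = (R div cf_q a (int m)) * cf_q a (int m)" by (simp add: c_def)
    then show ?thesis using mod mod_bounds q by linarith
  next
    case False
    then have "c = a (Suc m)" by (simp add: c_def)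
    then show ?thesis using Suc.prems cf_q_step[of a m] by (simp add: add.commute)
  qed
  ultimately obtain b where b: "R - c * cf_q a (int m) = (\<Sum>j<m. b j * cf_q a (int j))"
      "\<forall>j<m. 0 \<le> b j \<and> b j \<le> a (j + 1)"
    using Suc.IH by blast
  show ?case
    by (intro exI[of _ "b(m := c)"]) (use b c in \<open>auto simp: less_Suc_eq\<close>)
qed

text \<open>
  Consecutive ranges \<open>[q\<^sub>k + 1, q\<^sub>k\<^sub>+\<^sub>1 + q\<^sub>k)\<close> leave no integer \<open>\<ge> 2\<close> uncovered. The top digit
  \<open>c\<close> is chosen so that \<open>N - c q\<^sub>m\<close> lies in \<open>[q\<^sub>m\<^sub>-\<^sub>1, q\<^sub>m + q\<^sub>m\<^sub>-\<^sub>1)\<close>: the lower end makes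
  the number of gaps of the first length nonnegative, and the upper end is what the lower digits can
  represent.
\<close>
lemma amended_ostrowski_exists:
  assumes a: "\<And>i. i \<ge> 1 \<Longrightarrow> a i \<ge> 1" and N: "N \<ge> 2"
  shows "\<exists>m b. amended_ostrowski a N m b \<and>
    0 \<le> int N - b m * cf_q a (int m) - cf_q a (int m - 1)"
proof -
  define below where "below = (\<lambda>k::nat. int N < cf_q a (int k + 1) + cf_q a (int k))"
  define in_range where "in_range = (\<lambda>k::nat. cf_q a (int k) + 1 \<le> int N \<and> below k)"
  have "below N" unfolding below_def using a by (rule cf_q_sum_unbounded)
  define l where "l = (LEAST k. below k)"
  have "below l" unfolding l_def using \<open>below N\<close> by (rule LeastI)
  moreover have "cf_q a (int l) + 1 \<le> int N"
  proof (cases l)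
    case (Suc k)
    then have "\<not> below k" unfolding l_def by (intro not_less_Least) auto
    then show ?thesis using Suc cf_q_pos[of a k] a by (auto simp: below_def add.commute)
  qed (use N in \<open>simp add: cf_pq_zero\<close>)
  ultimately have "in_range l" by (simp add: in_range_def)
  define m where "m = (LEAST k. in_range k)"
  have m: "in_range m" unfolding m_def using \<open>in_range l\<close> by (rule LeastI)
  have minimal: "\<not> in_range k" if "k < m" for k
    using that unfolding m_def by (rule not_less_Least)
  have q: "cf_q a (int m) \<ge> 1" using a by (rule cf_q_pos)
  define c where "c = (int N - cf_q a (int m - 1)) div cf_q a (int m)"
  define R where "R = int N - c * cf_q a (int m)"
  have nonneg: "0 \<le> int N - cf_q a (int m - 1)"
    using m cf_q_mono[of a m] a by (auto simp: in_range_def)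
  have "c * cf_q a (int m) + (int N - cf_q a (int m - 1)) mod cf_q a (int m) =
      int N - cf_q a (int m - 1)"
    unfolding c_def by (rule div_mult_mod_eq)
  moreover have "0 \<le> (int N - cf_q a (int m - 1)) mod cf_q a (int m)"
    "(int N - cf_q a (int m - 1)) mod cf_q a (int m) < cf_q a (int m)"
    using q by auto
  ultimately have R: "cf_q a (int m - 1) \<le> R" "R < cf_q a (int m) + cf_q a (int m - 1)"
    unfolding R_def by linarith+
  have "c * cf_q a (int m) < (a (Suc m) + 1) * cf_q a (int m)"
    using R m cf_q_step[of a m] by (simp add: R_def in_range_def below_def algebra_simps)
  then have "c < a (Suc m) + 1" using q by (simp add: mult_less_cancel_right)
  then have c: "0 \<le> c" "c \<le> a (Suc m)"
    using nonneg q by (auto simp: c_def pos_imp_zdiv_nonneg_iff)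
  obtain b where b: "R = (\<Sum>j<m. b j * cf_q a (int j))" "\<forall>j<m. 0 \<le> b j \<and> b j \<le> a (j + 1)"
    using greedy_digits_exist[of a R m] a R cf_q_nonneg[of a m] by force
  have "amended_ostrowski a N m (b(m := c))"
    unfolding amended_ostrowski_def Let_def
    using m minimal b c
    by (auto simp: in_range_def below_def R_def le_less atLeast0AtMost lessThan_Suc_atMost[symmetric])
  moreover have "0 \<le> int N - (b(m := c)) m * cf_q a (int m) - cf_q a (int m - 1)"
    using R by (simp add: R_def)
  ultimately show ?thesis by blast
qed

section \<open>The three gap lengths in terms of the top digit\<close>

text \<open>
  The determinant condition on the two steps \<open>q\<^sub>m\<close> and \<open>Q\<close> reduces to that of the convergents
  \<open>m\<close> and \<open>m - 1\<close>, because adding \<open>c\<close> times one column to the other does not change it. The parity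
  of \<open>m\<close> decides which of the steps goes forwards. The last three claims make the three lengths
  pairwise different, so that their multiplicities can be read off.
\<close>
lemma mset_gap_lengths_ostrowski:
  assumes z: "z \<notin> \<rat>" "0 < z" "z < 1" and a: "cf_expansion z a"
    and c: "0 \<le> c" "c \<le> a (Suc m)"
    and range: "cf_q a (int m) \<le> int N"
      "c * cf_q a (int m) + cf_q a (int m - 1) \<le> int N"
      "int N \<le> (c + 1) * cf_q a (int m) + cf_q a (int m - 1)"
  defines "Q \<equiv> c * cf_q a (int m) + cf_q a (int m - 1)"
  defines "L2 \<equiv> cf_K z a (int m)"
  defines "L1 \<equiv> cf_K z a (int m - 1) - of_int c * cf_K z a (int m)"
  shows "mset (gap_lengths z N) = replicate_mset (nat (int N - Q)) L1 +
      replicate_mset (nat (int N - cf_q a (int m))) L2 +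
      replicate_mset (nat (cf_q a (int m) + Q - int N)) (L1 + L2)"
    and "L1 \<noteq> L2" "L1 > 0" "L2 > 0"
proof -
  have pos: "a i \<ge> 1" if "i \<ge> 1" for i using a that by (auto simp: cf_expansion_def)
  define q p P where "q = cf_q a (int m)" and "p = cf_p a (int m)"
    and "P = c * cf_p a (int m) + cf_p a (int m - 1)"
  have q1: "q \<ge> 1" and Q0: "Q \<ge> 0"
    using cf_q_pos[of a m] cf_q_nonneg[of a m] pos c by (auto simp: q_def Q_def)
  have N: "N \<ge> 1" using range(1) q1 by (simp add: q_def)
  have K: "cf_K z a (int m) = cf_dist z a (Suc m)" "cf_K z a (int m - 1) = cf_dist z a m"
    using cf_K_eq_cf_dist[OF z a, of "Suc m"] cf_K_eq_cf_dist[OF z a, of m] by auto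
  show L2: "L2 > 0" using cf_dist_pos[OF z(1) a] by (simp add: L2_def K)
  have "of_int c * L2 \<le> of_int (a (Suc m)) * L2" using c L2 by (intro mult_right_mono) auto
  then show L1: "L1 > 0"
    using cf_dist_pos[OF z(1) a, of "Suc (Suc m)"] by (simp add: L1_def L2_def K cf_dist_step)
  have L2_eq: "L2 = (- 1) ^ m * (of_int q * z - of_int p)"
    by (simp add: L2_def K cf_dist_def q_def p_def)
  have L1_eq: "L1 = (- 1) ^ m * (of_int P - of_int Q * z)"
    by (simp add: L1_def K cf_dist_def P_def Q_def algebra_simps)
  have det: "q * P - Q * p = (- 1) ^ m"
    using cf_determinant[of a m] by (simp add: q_def p_def P_def Q_def algebra_simps)
  show "L1 \<noteq> L2"
  proof
    assume "L1 = L2"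
    then have "of_int (q + Q) * z = of_int (p + P)"
      unfolding L1_eq L2_eq by (cases "even m") (simp_all add: algebra_simps)
    from irrational_linear[OF z(1) this] show False using q1 Q0 by simp
  qed
  have ranges: "nat q \<le> N" "nat Q \<le> N" "N \<le> nat q + nat Q"
    using range q1 Q0 by (auto simp: q_def Q_def nat_le_iff algebra_simps)
  have nats: "nat (int N - Q) = N - nat Q" "nat (int N - q) = N - nat q"
      "nat (q + Q - int N) = nat q + nat Q - N"
    using q1 Q0 by auto
  show "mset (gap_lengths z N) = replicate_mset (nat (int N - Q)) L1 +
      replicate_mset (nat (int N - cf_q a (int m))) L2 +
      replicate_mset (nat (cf_q a (int m) + Q - int N)) (L1 + L2)"
  proof (cases "even m")
    case True
    show ?thesis
      unfolding q_def[symmetric] nats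
      using mset_gap_lengths_three[of N "nat q" "nat Q" L2 z p L1 P] True N ranges L1 L2 q1 Q0 det
      by (simp add: L1_eq L2_eq ac_simps)
  next
    case False
    show ?thesis
      unfolding q_def[symmetric] nats
      using mset_gap_lengths_three[of N "nat Q" "nat q" L1 z P L2 p] False N ranges L1 L2 q1 Q0 det
      by (simp add: L1_eq L2_eq ac_simps)
  qed
qed

theorem theorem1:
  fixes z :: real and a :: "nat \<Rightarrow> int" and N :: nat
  assumes "z \<notin> \<rat>" and "0 < z" and "z < 1" and "cf_expansion z a" and "N \<ge> 2"
  shows
    "(\<exists>m b. amended_ostrowski a N m b \<and>
        0 \<le> int N - b m * cf_q a (int m) - cf_q a (int m - 1)) \<and>
     (\<forall>m b. amended_ostrowski a N m b \<longrightarrow>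
        0 \<le> int N - b m * cf_q a (int m) - cf_q a (int m - 1) \<longrightarrow>
        (let L1 = cf_K z a (int m - 1) - of_int (b m) * cf_K z a (int m);
             L2 = cf_K z a (int m);
             L3 = L1 + L2;
             N1 = int N - b m * cf_q a (int m) - cf_q a (int m - 1);
             N2 = int N - cf_q a (int m);
             N3 = cf_q a (int m) - (int N - b m * cf_q a (int m) - cf_q a (int m - 1));
             gaps = gap_lengths z N
         in set gaps \<subseteq> {L1, L2, L3} \<and> card (set gaps) \<le> 3 \<and>
            int (count_list gaps L1) = N1 \<and>
            int (count_list gaps L2) = N2 \<and>
            int (count_list gaps L3) = N3))"
proof (intro conjI allI impI)
  have pos: "a i \<ge> 1" if "i \<ge> 1" for i using assms(4) that by (auto simp: cf_expansion_def)
  then show "\<exists>m b. amended_ostrowski a N m b \<and>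
      0 \<le> int N - b m * cf_q a (int m) - cf_q a (int m - 1)"
    using assms(5) by (rule amended_ostrowski_exists)
  fix m b
  assume ost: "amended_ostrowski a N m b"
    and N1: "0 \<le> int N - b m * cf_q a (int m) - cf_q a (int m - 1)"
  define q Q where "q = cf_q a (int m)" and "Q = b m * cf_q a (int m) + cf_q a (int m - 1)"
  define L1 L2 where "L1 = cf_K z a (int m - 1) - of_int (b m) * cf_K z a (int m)"
    and "L2 = cf_K z a (int m)"
  have sum: "int N = (\<Sum>j<m. b j * cf_q a (int j)) + b m * q"
    and digits: "\<And>j. j \<le> m \<Longrightarrow> 0 \<le> b j \<and> b j \<le> a (j + 1)" and qN: "q + 1 \<le> int N"
    using ost unfolding amended_ostrowski_def Let_def q_def
    by (auto simp: atLeast0AtMost lessThan_Suc_atMost[symmetric])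
  have "(\<Sum>j<m. b j * cf_q a (int j)) < q + cf_q a (int m - 1)"
    unfolding q_def using pos digits by (intro digit_sum_less) auto
  then have upper: "int N < q + Q" using sum by (simp add: Q_def q_def)
  have lower: "Q \<le> int N" using N1 by (simp add: Q_def)
  have "mset (gap_lengths z N) = replicate_mset (nat (int N - Q)) L1 +
      replicate_mset (nat (int N - q)) L2 + replicate_mset (nat (q + Q - int N)) (L1 + L2)"
    and distinct: "L1 \<noteq> L2" "L1 > 0" "L2 > 0"
    using mset_gap_lengths_ostrowski[OF assms(1-4), of "b m" m N] digits[of m] qN lower upper
    by (simp_all add: L1_def L2_def q_def Q_def algebra_simps)
  note gaps = this(1)
  have "set_mset (mset (gap_lengths z N)) \<subseteq> {L1, L2, L1 + L2}"
    unfolding gaps by (auto split: if_splits)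
  then have "set (gap_lengths z N) \<subseteq> {L1, L2, L1 + L2}" by simp
  moreover have "card {L1, L2, L1 + L2} \<le> 3" by (simp add: card_insert_if)
  then have "card (set (gap_lengths z N)) \<le> 3"
    using card_mono[OF _ calculation] by simp
  moreover have count: "count_list (gap_lengths z N) x = count (mset (gap_lengths z N)) x" for x
    by (simp add: count_mset)
  have "int (count_list (gap_lengths z N) L1) = int N - Q"
    "int (count_list (gap_lengths z N) L2) = int N - q"
    "int (count_list (gap_lengths z N) (L1 + L2)) = q - (int N - Q)"
    unfolding count gaps using distinct qN lower upper by auto
  ultimately show "let L1 = cf_K z a (int m - 1) - of_int (b m) * cf_K z a (int m);
      L2 = cf_K z a (int m);
      L3 = L1 + L2;
      N1 = int N - b m * cf_q a (int m) - cf_q a (int m - 1);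
      N2 = int N - cf_q a (int m);
      N3 = cf_q a (int m) - (int N - b m * cf_q a (int m) - cf_q a (int m - 1));
      gaps = gap_lengths z N
    in set gaps \<subseteq> {L1, L2, L3} \<and> card (set gaps) \<le> 3 \<and>
      int (count_list gaps L1) = N1 \<and>
      int (count_list gaps L2) = N2 \<and>
      int (count_list gaps L3) = N3"
    unfolding Let_def L1_def L2_def q_def Q_def by (simp add: algebra_simps)
qed

end
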